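(* Let $n\ge1$, let $\xi$ be a random vector uniformly distributed over the unit $l_1$-norm ball $Q=\{x\in\mathbb{R}^n:\sum_{i=1}^n|x_i|\le1\}$, and let $g(x)=x_1$ (so the true maximum of $g$ on $Q$ is $1$). Let $p\in(0,1)$ and $\delta\in(0,1)$. Then the minimal sample size $N_{\min}$ that guarantees, with probability at least $p$, that the empirical maximum of $g$ is an at least $\delta$-accurate estimate of the true maximum is $$ N_{\min}=\left\lceil\frac{\ln(1-p)}{\ln\bigl(1-\frac12\delta^n\bigr)}\right\rceil . $$ Moreover, for small $\delta$, $$ N_{\min}\approx-\frac{\ln(1-p)}{0.5\,\delta^n}, $$ in the sense that, for fixed $n$ and $p$, the ratio of the two sides tends to $1$ as $\delta\to0^+$.
   Context: For a positive integer $N$, let $\xi^{(1)},\dots,\xi^{(N)}$ be independent copies of $\xi$ (a multisample of size $N$). The empirical maximum is $\eta=\max_{1\le i\le N}g(\xi^{(i)})$. With $\eta^*=\max_{x\in Q}g(x)$ the true maximum, $\eta$ is an at least $\delta$-accurate estimate of $\eta^*$ if $(\eta^*-\eta)/\eta^*\le\delta$. Thus $N_{\min}$ is the smallest positive integer $N$ for which this event has probability at least $p$. *)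

theory Defs
  imports "HOL-Probability.Probability"
begin

definition l1_ball :: "(real ^ 'n) set" where
  "l1_ball = {x. (\<Sum>i\<in>UNIV. \<bar>x $ i\<bar>) \<le> 1}"

definition uniformly_distributed_on ::
  "'b measure \<Rightarrow> ('b \<Rightarrow> 'c::euclidean_space) \<Rightarrow> 'c set \<Rightarrow> bool" where
  "uniformly_distributed_on P \<xi> Q \<longleftrightarrow>
     \<xi> \<in> borel_measurable P \<and> distr P borel \<xi> = uniform_measure lborel Q"

definition multisample ::
  "'b measure \<Rightarrow> ('b \<Rightarrow> 'c::euclidean_space) \<Rightarrow> nat \<Rightarrow> 'a measure \<Rightarrow> (nat \<Rightarrow> 'a \<Rightarrow> 'c) \<Rightarrow> bool" where
  "multisample P \<xi> N M X \<longleftrightarrow>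
     prob_space M \<and>
     prob_space.indep_vars M (\<lambda>_. borel) X {1..N} \<and>
     (\<forall>i\<in>{1..N}. distr M borel (X i) = distr P borel \<xi>)"

definition empirical_max :: "('c \<Rightarrow> real) \<Rightarrow> nat \<Rightarrow> (nat \<Rightarrow> 'a \<Rightarrow> 'c) \<Rightarrow> 'a \<Rightarrow> real" where
  "empirical_max g N X \<omega> = Max ((\<lambda>i. g (X i \<omega>)) ` {1..N})"

definition true_max :: "('c \<Rightarrow> real) \<Rightarrow> 'c set \<Rightarrow> real" where
  "true_max g Q = (GREATEST y. y \<in> g ` Q)"

definition accurate_estimate :: "real \<Rightarrow> real \<Rightarrow> real \<Rightarrow> bool" where
  "accurate_estimate \<delta> \<eta>' \<eta> \<longleftrightarrow> (\<eta>' - \<eta>) / \<eta>' \<le> \<delta>"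

(* M N is the probability space carrying a multisample X N 1, ..., X N N of size N. *)
definition sufficient_sample_size ::
  "(nat \<Rightarrow> 'a measure) \<Rightarrow> (nat \<Rightarrow> nat \<Rightarrow> 'a \<Rightarrow> 'c) \<Rightarrow> ('c \<Rightarrow> real) \<Rightarrow> 'c set \<Rightarrow>
     real \<Rightarrow> real \<Rightarrow> nat \<Rightarrow> bool" where
  "sufficient_sample_size M X g Q p \<delta> N \<longleftrightarrow>
     1 \<le> N \<and>
     p \<le> measure (M N) {\<omega> \<in> space (M N).
            accurate_estimate \<delta> (true_max g Q) (empirical_max g N (X N) \<omega>)}"

definition N_min ::
  "(nat \<Rightarrow> 'a measure) \<Rightarrow> (nat \<Rightarrow> nat \<Rightarrow> 'a \<Rightarrow> 'c) \<Rightarrow> ('c \<Rightarrow> real) \<Rightarrow> 'c set \<Rightarrow>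
     real \<Rightarrow> real \<Rightarrow> nat" where
  "N_min M X g Q p \<delta> = (LEAST N. sufficient_sample_size M X g Q p \<delta> N)"

end

(* The cap {x in Q. 1 - \<delta> \<le> x_k} is the image of the half ball {x in Q. 0 \<le> x_k} under the
   homothety with ratio \<delta> centred at the vertex e_k, and the half ball is half of Q by the symmetry
   x \<mapsto> -x. So one sample point misses the cap with probability 1 - \<delta>^n / 2, a multisample of size N
   misses it with probability (1 - \<delta>^n / 2)^N, and this is at most 1 - p exactly when N is at least
   r = ln (1 - p) / ln (1 - \<delta>^n / 2). The asymptotics follow from ln (1 - c) \<sim> -c, since rounding r up
   changes it by less than 1 while r tends to infinity. *)

theory Submission imports Defs "HOL-Real_Asymp.Real_Asymp" begin

section \<open>Volumes of the ball, the half ball and the cap\<close>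

lemma closed_l1_ball: "closed (l1_ball :: (real ^ 'n) set)"
  unfolding l1_ball_def by (intro closed_Collect_le continuous_intros)

lemma compact_l1_ball: "compact (l1_ball :: (real ^ 'n) set)"
proof -
  have "(l1_ball :: (real ^ 'n) set) \<subseteq> cball 0 1"
    using norm_le_l1_cart by (force simp: l1_ball_def intro: order_trans)
  thus ?thesis
    using closed_l1_ball bounded_subset[OF bounded_cball] by (auto simp: compact_eq_bounded_closed)
qed

text \<open>The open unit ball of the l1 norm lies inside and is nonempty. Positivity lets the
  uniform measure be computed as a quotient of volumes.\<close>

lemma measure_l1_ball_pos: "measure lebesgue (l1_ball :: (real ^ 'n) set) > 0"
proof -
  let ?S = "{x :: real ^ 'n. (\<Sum>i\<in>UNIV. \<bar>x $ i\<bar>) < 1}"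
  have "open ?S" by (intro open_Collect_less continuous_intros)
  moreover have "0 \<in> ?S" by simp
  ultimately have "\<not> negligible ?S" using open_not_negligible[of ?S] by blast
  hence "\<not> negligible (l1_ball :: (real ^ 'n) set)"
    by (rule contrapos_nn) (erule negligible_subset, auto simp: l1_ball_def)
  moreover have "(l1_ball :: (real ^ 'n) set) \<in> lmeasurable"
    by (rule lmeasurable_compact[OF compact_l1_ball])
  ultimately show ?thesis
    by (metis negligible_iff_measure0 measure_nonneg less_eq_real_def)
qed

lemma measure_l1_half_ball:
  fixes k :: "'n :: finite"
  shows "measure lebesgue {x \<in> l1_ball :: (real ^ 'n) set. 0 \<le> x $ k}
           = measure lebesgue (l1_ball :: (real ^ 'n) set) / 2"
proof -
  let ?A = "{x \<in> l1_ball :: (real ^ 'n) set. 0 \<le> x $ k}"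
  let ?B = "{x \<in> l1_ball :: (real ^ 'n) set. x $ k \<le> 0}"
  have cl: "closed {x :: real ^ 'n. 0 \<le> x $ k}" "closed {x :: real ^ 'n. x $ k \<le> 0}"
    by (intro closed_Collect_le continuous_intros)+
  have "compact ?A" "compact ?B"
    using compact_Int_closed[OF compact_l1_ball cl(1)] compact_Int_closed[OF compact_l1_ball cl(2)]
    by (simp_all add: Int_def)
  hence lm: "?A \<in> lmeasurable" "?B \<in> lmeasurable" by (auto intro: lmeasurable_compact)
  \<comment> \<open>The reflection is written as an affine map with ratio -1, so that the scaling
    law for Lebesgue measure applies with factor 1.\<close>
  have "?B = (\<lambda>x. (-1) *\<^sub>R x + 0) ` ?A"
  proof (intro equalityI subsetI)
    fix x assume "x \<in> ?B"
    thus "x \<in> (\<lambda>x. (-1) *\<^sub>R x + 0) ` ?A"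
      by (intro image_eqI[of _ _ "- x"]) (auto simp: l1_ball_def)
  qed (auto simp: l1_ball_def)
  hence "measure lebesgue ?B = measure lebesgue ?A"
    using measure_lebesgue_affine[of "-1" 0 ?A] by simp
  \<comment> \<open>The two closed halves meet only inside a hyperplane, which is null.\<close>
  moreover have "measure lebesgue (?A \<inter> ?B) = 0"
    by (intro negligible_imp_measure0 negligible_subset[OF negligible_standard_hyperplane_cart[of k]]) auto
  moreover have "l1_ball = ?A \<union> ?B" by auto
  ultimately show ?thesis using measure_Un3[OF lm] by simp
qed

text \<open>The translation affects coordinate \<open>k\<close> only. When that coordinate is
  nonnegative, the absolute values open up and the homothety multiplies (l1 norm) - 1 by
  \<open>\<delta>\<close>, so membership in the ball is preserved in both directions.\<close>

lemma l1_cap_eq_image: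
  fixes k :: "'n :: finite"
  assumes "0 < \<delta>" "\<delta> < 1"
  shows "{x \<in> l1_ball :: (real ^ 'n) set. 1 - \<delta> \<le> x $ k}
           = (\<lambda>x. \<delta> *\<^sub>R x + axis k (1 - \<delta>)) ` {x \<in> l1_ball. 0 \<le> x $ k}"
proof -
  let ?T = "\<lambda>x :: real ^ 'n. \<delta> *\<^sub>R x + axis k (1 - \<delta>)"
  have split: "(\<Sum>i\<in>UNIV. \<bar>x $ i\<bar>) = \<bar>x $ k\<bar> + (\<Sum>i\<in>UNIV - {k}. \<bar>x $ i\<bar>)" for x :: "real ^ 'n"
    by (simp add: sum.remove)
  have iff: "?T y \<in> l1_ball \<and> 1 - \<delta> \<le> ?T y $ k \<longleftrightarrow> y \<in> l1_ball \<and> 0 \<le> y $ k" for y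
  proof -
    have k: "1 - \<delta> \<le> ?T y $ k \<longleftrightarrow> 0 \<le> y $ k"
      using assms by (simp add: axis_def zero_le_mult_iff)
    have "(\<Sum>i\<in>UNIV. \<bar>?T y $ i\<bar>) \<le> 1 \<longleftrightarrow> (\<Sum>i\<in>UNIV. \<bar>y $ i\<bar>) \<le> 1" if "0 \<le> y $ k"
    proof -
      have "(\<Sum>i\<in>UNIV - {k}. \<bar>?T y $ i\<bar>) = \<delta> * (\<Sum>i\<in>UNIV - {k}. \<bar>y $ i\<bar>)"
        unfolding sum_distrib_left using assms
        by (intro sum.cong) (auto simp: axis_def abs_mult)
      moreover have "\<bar>?T y $ k\<bar> = \<delta> * \<bar>y $ k\<bar> + (1 - \<delta>)"
        using assms that by (simp add: axis_def)
      ultimately have "(\<Sum>i\<in>UNIV. \<bar>?T y $ i\<bar>) - 1 = \<delta> * ((\<Sum>i\<in>UNIV. \<bar>y $ i\<bar>) - 1)"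
        unfolding split by (simp add: algebra_simps)
      thus ?thesis
        using assms by (metis diff_le_0_iff_le mult_le_0_iff not_less order.asym)
    qed
    thus ?thesis using k by (auto simp: l1_ball_def)
  qed
  \<comment> \<open>The explicit inverse of the homothety gives the preimage of a point of the
    cap.\<close>
  have surj: "?T ((1 / \<delta>) *\<^sub>R (x - axis k (1 - \<delta>))) = x" for x
    using assms by simp
  show ?thesis
  proof (intro equalityI subsetI)
    fix x assume "x \<in> {x \<in> l1_ball :: (real ^ 'n) set. 1 - \<delta> \<le> x $ k}"
    with iff[of "(1 / \<delta>) *\<^sub>R (x - axis k (1 - \<delta>))"]
    show "x \<in> ?T ` {x \<in> l1_ball. 0 \<le> x $ k}"
      unfolding surj by (intro rev_image_eqI[where f = ?T, OF _ surj[symmetric]]) blast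
  next
    fix x assume "x \<in> ?T ` {x \<in> l1_ball. 0 \<le> x $ k}"
    thus "x \<in> {x \<in> l1_ball :: (real ^ 'n) set. 1 - \<delta> \<le> x $ k}" using iff by blast
  qed
qed

lemma measure_l1_cap:
  fixes k :: "'n :: finite"
  assumes "0 < \<delta>" "\<delta> < 1"
  shows "measure lebesgue {x \<in> l1_ball :: (real ^ 'n) set. 1 - \<delta> \<le> x $ k}
           = 1 / 2 * \<delta> ^ CARD('n) * measure lebesgue (l1_ball :: (real ^ 'n) set)"
  unfolding l1_cap_eq_image[OF assms] measure_lebesgue_affine measure_l1_half_ball
  using assms by simp

text \<open>Passes to the complement of the cap: missing it is the event whose probabilities
  multiply over independent sample points.\<close>

lemma measure_uniform_l1_below_cap:
  fixes k :: "'n :: finite"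
  assumes "0 < \<delta>" "\<delta> < 1"
  shows "measure (uniform_measure lborel (l1_ball :: (real ^ 'n) set)) {x. x $ k < 1 - \<delta>}
           = 1 - 1 / 2 * \<delta> ^ CARD('n)"
proof -
  let ?Q = "l1_ball :: (real ^ 'n) set"
  let ?C = "{x \<in> ?Q. 1 - \<delta> \<le> x $ k}"
  have cl: "closed {x :: real ^ 'n. 1 - \<delta> \<le> x $ k}" by (intro closed_Collect_le continuous_intros)
  have C: "compact ?C" using compact_Int_closed[OF compact_l1_ball cl] by (simp add: Int_def)
  have O: "open {x :: real ^ 'n. x $ k < 1 - \<delta>}" by (intro open_Collect_less continuous_intros)
  have Qb: "?Q \<in> sets borel" and Cb: "?C \<in> sets borel"
    using compact_l1_ball C by (auto intro: borel_compact)
  have "measure lebesgue ?Q > 0" by (rule measure_l1_ball_pos)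
  hence Qpos: "measure lborel ?Q > 0" using Qb by simp
  have eq: "?Q \<inter> {x. x $ k < 1 - \<delta>} = ?Q - ?C" by auto
  have "measure lborel (?Q - ?C) = measure lborel ?Q - measure lborel ?C"
    using emeasure_compact_finite[OF compact_l1_ball] Qb Cb
    by (intro measure_Diff) (auto simp: less_top)
  also have "measure lborel ?C = 1 / 2 * \<delta> ^ CARD('n) * measure lborel ?Q"
    using measure_l1_cap[OF assms, of k] Qb Cb by simp
  finally have "measure lborel (?Q \<inter> {x. x $ k < 1 - \<delta>})
                  = (1 - 1 / 2 * \<delta> ^ CARD('n)) * measure lborel ?Q"
    unfolding eq by (simp add: algebra_simps)
  \<comment> \<open>\<open>measure\<close> sends both 0 and infinity to 0, so a positive value
    excludes both.\<close>
  moreover have "emeasure lborel ?Q \<noteq> 0" using Qpos by (auto simp: measure_def)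
  moreover have "emeasure lborel ?Q \<noteq> \<infinity>"
    using Qpos by (auto simp: measure_def)
  ultimately show ?thesis
    using Qpos O by (subst measure_uniform_measure) auto
qed

section \<open>The true and the empirical maximum\<close>

lemma true_max_coordinate_l1_ball: "true_max (\<lambda>x. x $ k) (l1_ball :: (real ^ 'n) set) = 1"
  unfolding true_max_def
proof (rule Greatest_equality)
  have "(\<Sum>i\<in>UNIV. \<bar>axis k 1 $ i\<bar>) = (1 :: real)"
    by (subst sum.remove[of _ k]) (auto simp: axis_def)
  thus "1 \<in> (\<lambda>x. x $ k) ` (l1_ball :: (real ^ 'n) set)"
    by (intro image_eqI[of _ _ "axis k 1"]) (auto simp: l1_ball_def axis_def)
next
  fix y assume "y \<in> (\<lambda>x. x $ k) ` (l1_ball :: (real ^ 'n) set)"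
  then obtain x :: "real ^ 'n" where x: "y = x $ k" "(\<Sum>i\<in>UNIV. \<bar>x $ i\<bar>) \<le> 1"
    by (auto simp: l1_ball_def)
  have "\<bar>x $ k\<bar> \<le> (\<Sum>i\<in>UNIV. \<bar>x $ i\<bar>)" by (rule member_le_sum) auto
  with x show "y \<le> 1" by linarith
qed

text \<open>The maximum stays below \<open>t\<close> exactly when every sample point does, and by
  independence this has probability \<open>q ^ N\<close>.\<close>

lemma prob_max_ge:
  fixes X :: "nat \<Rightarrow> 'a \<Rightarrow> 'c :: euclidean_space"
  assumes ms: "multisample P \<xi> N M X" and N: "1 \<le> N" and g: "g \<in> borel_measurable borel"
    and q: "measure (distr P borel \<xi>) {x. g x < t} = q"
  shows "measure M {\<omega> \<in> space M. t \<le> empirical_max g N X \<omega>} = 1 - q ^ N"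
proof -
  interpret prob_space M using ms by (simp add: multisample_def)
  have ind: "indep_vars (\<lambda>_. borel) X {1..N}" using ms by (simp add: multisample_def)
  hence rv: "X i \<in> borel_measurable M" if "i \<in> {1..N}" for i
    using that by (auto simp: indep_vars_def)
  define B where "B = {x. g x < t}"
  have B: "B \<in> sets borel" using g unfolding B_def by measurable
  define A where "A i = X i -` B \<inter> space M" for i
  have Ae: "A i \<in> events" if "i \<in> {1..N}" for i
    unfolding A_def using rv[OF that] B by measurable
  have "prob (A i) = q" if "i \<in> {1..N}" for i
  proof -
    have "prob (A i) = measure (distr M borel (X i)) B"
      unfolding A_def using rv[OF that] B by (simp add: measure_distr)
    thus ?thesis using ms that q by (simp add: multisample_def B_def)
  qed
  \<comment> \<open>The product rule is stated for nonempty finite index sets;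
    \<open>1 \<le> N\<close> provides nonemptiness.\<close>
  moreover have "prob (\<Inter>i\<in>{1..N}. A i) = (\<Prod>i\<in>{1..N}. prob (A i))"
    using ind N B unfolding indep_vars_def2 A_def by (elim conjE) (erule indep_setsD, auto)
  ultimately have prod: "prob (\<Inter>i\<in>{1..N}. A i) = q ^ N" by simp
  have "{\<omega> \<in> space M. t \<le> empirical_max g N X \<omega>} = space M - (\<Inter>i\<in>{1..N}. A i)"
    using N by (fastforce simp: empirical_max_def Max_ge_iff A_def B_def not_less)
  moreover have "(\<Inter>i\<in>{1..N}. A i) \<in> events" using N Ae by (intro sets.finite_INT) auto
  ultimately show ?thesis using prob_compl prod by simp
qed

section \<open>Solving for the sample size, and its asymptotics\<close>

lemma power_le_iff_ln_ratio_le: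
  fixes a b :: real
  assumes "0 < a" "a < 1" "0 < b"
  shows "a ^ N \<le> b \<longleftrightarrow> ln b / ln a \<le> real N"
proof -
  have "a ^ N \<le> b \<longleftrightarrow> real N * ln a \<le> ln b"
    using assms by (metis ln_le_cancel_iff ln_realpow zero_less_power)
  \<comment> \<open>\<open>ln a\<close> is negative, so dividing by it reverses the
    inequality.\<close>
  thus ?thesis using assms by (simp add: neg_divide_le_eq)
qed

text \<open>Since \<open>r\<close> is positive, its ceiling is at least 1, so it meets
  \<open>1 \<le> N\<close> and \<open>nat\<close> does not truncate it.\<close>

lemma Least_nat_ge_eq_ceiling:
  fixes r :: real
  assumes "0 < r"
  shows "(LEAST N. 1 \<le> N \<and> r \<le> real N) = nat \<lceil>r\<rceil>"
  using assms by (intro Least_equality) (auto, linarith+)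

text \<open>Stated in the cap probability \<open>c\<close>, with the dimension entering only by a
  later substitution. Without rounding the ratio is \<open>- c / ln (1 - c)\<close>, which tends to
  1.\<close>

lemma ceiling_ln_ratio_asymp:
  fixes b :: real
  assumes "0 < b" "b < 1"
  shows "((\<lambda>c. of_int \<lceil>ln b / ln (1 - c)\<rceil> / (- (ln b / c))) \<longlongrightarrow> 1) (at_right 0)"
proof (rule tendsto_sandwich)
  define L where "L = - ln b"
  have L: "L > 0" using assms by (simp add: L_def)
  let ?lo = "\<lambda>c :: real. - c / ln (1 - c)"
  \<comment> \<open>Rounding up adds at most 1 to the numerator; divided by \<open>L / c\<close>
    this is the vanishing term \<open>c / L\<close>.\<close>
  let ?up = "\<lambda>c :: real. - c / ln (1 - c) + c / L"
  have ev: "eventually (\<lambda>c. c \<in> {0<..<1}) (at_right (0 :: real))"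
    by (rule eventually_at_right_real) simp
  have r: "ln b / ln (1 - c) / (- (ln b / c)) = - c / ln (1 - c)" if "c \<in> {0<..<1}" for c
    using that L by (auto simp: L_def field_simps)
  have s: "- (ln b / c) > 0" if "c \<in> {0<..<1}" for c
    using that L by (auto simp: L_def field_simps)
  show "eventually (\<lambda>c. ?lo c \<le> of_int \<lceil>ln b / ln (1 - c)\<rceil> / (- (ln b / c))) (at_right 0)"
    using ev
  proof eventually_elim
    case (elim c)
    have "ln b / ln (1 - c) / (- (ln b / c)) \<le> of_int \<lceil>ln b / ln (1 - c)\<rceil> / (- (ln b / c))"
      using s[OF elim] by (intro divide_right_mono) auto
    thus ?case unfolding r[OF elim] .
  qed
  show "eventually (\<lambda>c. of_int \<lceil>ln b / ln (1 - c)\<rceil> / (- (ln b / c)) \<le> ?up c) (at_right 0)"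
    using ev
  proof eventually_elim
    case (elim c)
    have "of_int \<lceil>ln b / ln (1 - c)\<rceil> / (- (ln b / c)) \<le> (ln b / ln (1 - c) + 1) / (- (ln b / c))"
      using s[OF elim] by (intro divide_right_mono of_int_ceiling_le_add_one) auto
    also have "\<dots> = ln b / ln (1 - c) / (- (ln b / c)) + 1 / (- (ln b / c))"
      by (rule add_divide_distrib)
    also have "1 / (- (ln b / c)) = c / L" by (simp add: L_def)
    finally show ?case unfolding r[OF elim] .
  qed
  show "(?lo \<longlongrightarrow> 1) (at_right 0)" by real_asymp
  show "(?up \<longlongrightarrow> 1) (at_right 0)" using L by real_asymp
qed

theorem theorem6:
  fixes P :: "'b measure" and \<xi> :: "'b \<Rightarrow> real ^ 'n"
    and M :: "nat \<Rightarrow> 'a measure" and X :: "nat \<Rightarrow> nat \<Rightarrow> 'a \<Rightarrow> real ^ 'n"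
    and k :: 'n and p :: real
  assumes "prob_space P"
    and "uniformly_distributed_on P \<xi> l1_ball"
    and "\<And>N. 1 \<le> N \<Longrightarrow> multisample P \<xi> N (M N) (X N)"
    and "0 < p" and "p < 1"
  shows "true_max (\<lambda>x. x $ k) (l1_ball :: (real ^ 'n) set) = 1 \<and>
    (\<forall>\<delta>. 0 < \<delta> \<and> \<delta> < 1 \<longrightarrow>
       sufficient_sample_size M X (\<lambda>x. x $ k) l1_ball p \<delta> (N_min M X (\<lambda>x. x $ k) l1_ball p \<delta>) \<and>
       int (N_min M X (\<lambda>x. x $ k) l1_ball p \<delta>)
         = \<lceil>ln (1 - p) / ln (1 - 1 / 2 * \<delta> ^ CARD('n))\<rceil>) \<and>
    ((\<lambda>\<delta>. real (N_min M X (\<lambda>x. x $ k) l1_ball p \<delta>) / (- (ln (1 - p) / (0.5 * \<delta> ^ CARD('n)))))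
       \<longlongrightarrow> 1) (at_right 0)"
proof -
  let ?g = "\<lambda>x :: real ^ 'n. x $ k" and ?c = "\<lambda>\<delta> :: real. 1 / 2 * \<delta> ^ CARD('n)"
  let ?N = "N_min M X ?g l1_ball p"
  have c: "0 < ?c \<delta>" "?c \<delta> < 1" if "0 < \<delta>" "\<delta> < 1" for \<delta>
    using that power_le_one[of \<delta> "CARD('n)"] by auto
  \<comment> \<open>Sufficiency becomes a lower bound on \<open>N\<close>; both the value of
    \<open>N_min\<close> and its sufficiency are read off from this.\<close>
  have suff: "sufficient_sample_size M X ?g l1_ball p \<delta> N \<longleftrightarrow>
      1 \<le> N \<and> ln (1 - p) / ln (1 - ?c \<delta>) \<le> real N" if \<delta>: "0 < \<delta>" "\<delta> < 1" for \<delta> N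
  proof (cases "1 \<le> N")
    case True
    have "measure (distr P borel \<xi>) {x. ?g x < 1 - \<delta>} = 1 - ?c \<delta>"
      using assms(2) measure_uniform_l1_below_cap[OF \<delta>] by (simp add: uniformly_distributed_on_def)
    hence "measure (M N) {\<omega> \<in> space (M N). 1 - \<delta> \<le> empirical_max ?g N (X N) \<omega>} = 1 - (1 - ?c \<delta>) ^ N"
      by (intro prob_max_ge[OF assms(3)[OF True] True]) auto
    \<comment> \<open>The true maximum is 1, so relative and absolute error coincide.\<close>
    moreover have "accurate_estimate \<delta> 1 \<eta> \<longleftrightarrow> 1 - \<delta> \<le> \<eta>" for \<eta>
      by (auto simp: accurate_estimate_def)
    ultimately have "sufficient_sample_size M X ?g l1_ball p \<delta> N \<longleftrightarrow> (1 - ?c \<delta>) ^ N \<le> 1 - p"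
      using True by (auto simp: sufficient_sample_size_def true_max_coordinate_l1_ball)
    also have "\<dots> \<longleftrightarrow> ln (1 - p) / ln (1 - ?c \<delta>) \<le> real N"
      using c[OF \<delta>] assms(5) by (intro power_le_iff_ln_ratio_le) auto
    finally show ?thesis using True by simp
  qed (auto simp: sufficient_sample_size_def)
  have r: "0 < ln (1 - p) / ln (1 - ?c \<delta>)" if "0 < \<delta>" "\<delta> < 1" for \<delta>
    using c[OF that] assms(4,5) by (intro divide_neg_neg) auto
  have N: "?N \<delta> = nat \<lceil>ln (1 - p) / ln (1 - ?c \<delta>)\<rceil>" if "0 < \<delta>" "\<delta> < 1" for \<delta>
    unfolding N_min_def suff[OF that] by (rule Least_nat_ge_eq_ceiling[OF r[OF that]])
  have N_int: "int (?N \<delta>) = \<lceil>ln (1 - p) / ln (1 - ?c \<delta>)\<rceil>" if "0 < \<delta>" "\<delta> < 1" for \<delta>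
    unfolding N[OF that] using r[OF that] by simp
  \<comment> \<open>Confirms that the \<open>LEAST\<close> in \<open>N_min\<close> is attained, so
    that it is not an unspecified value.\<close>
  have N_suff: "sufficient_sample_size M X ?g l1_ball p \<delta> (?N \<delta>)" if "0 < \<delta>" "\<delta> < 1" for \<delta>
    unfolding suff[OF that] N[OF that] using r[OF that] by (auto, linarith+)
  \<comment> \<open>Substitution \<open>c = \<delta> ^ n / 2\<close> with n the dimension: it tends
    to 0 because n is positive, and it does so from the right.\<close>
  have "filterlim ?c (at_right 0) (at_right 0)"
    unfolding filterlim_at
  proof
    have "(?c \<longlongrightarrow> 1 / 2 * 0 ^ CARD('n)) (at_right 0)" by (intro tendsto_intros)
    thus "(?c \<longlongrightarrow> 0) (at_right 0)" by (simp add: power_0_left)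
    show "eventually (\<lambda>\<delta>. ?c \<delta> \<in> {0<..} \<and> ?c \<delta> \<noteq> 0) (at_right 0)"
      using eventually_at_right_less[of "0 :: real"] by eventually_elim auto
  qed
  hence "((\<lambda>\<delta>. of_int \<lceil>ln (1 - p) / ln (1 - ?c \<delta>)\<rceil> / (- (ln (1 - p) / ?c \<delta>))) \<longlongrightarrow> 1) (at_right 0)"
    using assms(4,5) by (intro filterlim_compose[OF ceiling_ln_ratio_asymp]) auto
  \<comment> \<open>The ceiling formula is available only for \<open>\<delta>\<close> below 1, so
    the two functions agree only eventually.\<close>
  moreover have "eventually (\<lambda>\<delta>. of_int \<lceil>ln (1 - p) / ln (1 - ?c \<delta>)\<rceil> / (- (ln (1 - p) / ?c \<delta>))
      = real (?N \<delta>) / (- (ln (1 - p) / (0.5 * \<delta> ^ CARD('n))))) (at_right 0)"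
    using eventually_at_right_real[of 0 "1 :: real", OF zero_less_one]
  proof eventually_elim
    case (elim \<delta>)
    hence "of_int \<lceil>ln (1 - p) / ln (1 - ?c \<delta>)\<rceil> = real (?N \<delta>)"
      using N_int[of \<delta>] by (metis greaterThanLessThan_iff of_int_of_nat_eq)
    thus ?case by simp
  qed
  ultimately have "((\<lambda>\<delta>. real (?N \<delta>) / (- (ln (1 - p) / (0.5 * \<delta> ^ CARD('n))))) \<longlongrightarrow> 1) (at_right 0)"
    by (rule Lim_transform_eventually)
  thus ?thesis using true_max_coordinate_l1_ball N_int N_suff by blast
qed

end
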